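(* Let $n\ge1$ and $x,y\in\mathfrak{S}_n$. If $x\geq_B y$ and $y$ avoids $213$, then $x\unrhd_R y$.
   Context: Notation: $[m,n]=\{m,\dots,n\}$, $[n]=[1,n]$. For $a,b\in\mathbb{Z}^n$, $a\leq_C b$ means $a(i)\leq b(i)$ for all $i$. For $x\in[n]^n$ the conjugate is $x^*=(n+1-x(n),\dots,n+1-x(1))$. $\mathfrak{S}_n$ is the group of permutations of $[n]$. Parking functions: cars $1,\dots,n$ enter, in this order, a one-way street with spots $1,\dots,n$. Given $a\in[n]^n$, car $i$ parks in the first (lowest-numbered) available spot in $[a(i),n]$; if there is none, the procedure fails. If all cars park, $a$ is a parking function, and its outcome is the permutation $\mathcal{O}(a)=w\in\mathfrak{S}_n$, where car $i$ parks in spot $w(i)$. Interval parking functions (IPFs): given $a,b\in[n]^n$ with $a\leq_C b$, car $i$ parks in the first available spot in $[a(i),b(i)]$; if there is none, the procedure fails. If all cars park, $(a,b)$ is an interval parking function. If $(a,b)$ is an IPF, then both $a$ and $b^*$ are parking functions. Reachability: $x\unrhd_R y$ means there exists an IPF $(a,b)$ with $x=\mathcal{O}(a)$ and $y=\mathcal{O}(b^* )^*$. Bruhat order $\geq_B$ on $\mathfrak{S}_n$: the partial order generated by (reflexive-transitive closure of) the relations $x>t_{ij}x$ whenever $\ell(x)>\ell(t_{ij}x)$, where $t_{ij}$ is the transposition of $i$ and $j$, products are composed right to left, and $\ell(x)$ is the number of pairs $i<j$ with $x(i)>x(j)$. Pattern avoidance: $y$ avoids $213$ if there are no indices $i_1<i_2<i_3$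 with $y(i_2)<y(i_1)<y(i_3)$. *)

theory Defs
  imports "HOL-Combinatorics.Permutations" "HOL-Library.FuncSet"
begin

text \<open>
  A tuple in $[n]^n$ is a function in \<^term>\<open>{1..n} \<rightarrow> {1..n}\<close>; its values outside
  \<^term>\<open>{1..n}\<close> are irrelevant. A permutation of $[n]$ is a function satisfying
  \<^term>\<open>\<lambda>w. w permutes {1..n}\<close>, hence the identity outside \<^term>\<open>{1..n}\<close>.
\<close>

definition first_available :: "nat set \<Rightarrow> nat \<Rightarrow> nat \<Rightarrow> nat option" where
  "first_available occ l u =
     (if {l..u} - occ = {} then None else Some (Min ({l..u} - occ)))"

text \<open>
  \<open>park a b k\<close> is the assignment of spots to cars after cars $1,\dots,k$ have entered in this
  order, car $i$ being restricted to the interval $[a(i),b(i)]$; it is \<^const>\<open>None\<close> if the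
  procedure has failed.
\<close>

fun park :: "(nat \<Rightarrow> nat) \<Rightarrow> (nat \<Rightarrow> nat) \<Rightarrow> nat \<Rightarrow> (nat \<rightharpoonup> nat) option" where
  "park a b 0 = Some Map.empty"
| "park a b (Suc k) =
     (case park a b k of
        None \<Rightarrow> None
      | Some m \<Rightarrow>
          (case first_available (ran m) (a (Suc k)) (b (Suc k)) of
             None \<Rightarrow> None
           | Some s \<Rightarrow> Some (m(Suc k \<mapsto> s))))"

text \<open>
  The outcome is \<^const>\<open>None\<close> if some car fails to park. Otherwise the partial map is extended
  by the identity, to match the convention of \<^const>\<open>permutes\<close>.
\<close>

definition outcome :: "nat \<Rightarrow> (nat \<Rightarrow> nat) \<Rightarrow> (nat \<Rightarrow> nat) option" where
  "outcome n a =
     map_option (\<lambda>m i. case m i of None \<Rightarrow> i | Some s \<Rightarrow> s) (park a (\<lambda>_. n) n)"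

definition interval_parking_function :: "nat \<Rightarrow> (nat \<Rightarrow> nat) \<Rightarrow> (nat \<Rightarrow> nat) \<Rightarrow> bool" where
  "interval_parking_function n a b \<longleftrightarrow>
     a \<in> {1..n} \<rightarrow> {1..n} \<and> b \<in> {1..n} \<rightarrow> {1..n} \<and>
     (\<forall>i\<in>{1..n}. a i \<le> b i) \<and> park a b n \<noteq> None"

text \<open>Being the identity outside \<^term>\<open>{1..n}\<close>, the conjugate of a permutation permutes \<^term>\<open>{1..n}\<close>.\<close>

definition conjugate :: "nat \<Rightarrow> (nat \<Rightarrow> nat) \<Rightarrow> nat \<Rightarrow> nat" where
  "conjugate n x i = (if i \<in> {1..n} then n + 1 - x (n + 1 - i) else i)"

text \<open>
  If $(a,b)$ is an interval parking function, then $a$ and $b^*$ are parking functions, so that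
  both outcomes below exist.
\<close>

definition reachable :: "nat \<Rightarrow> (nat \<Rightarrow> nat) \<Rightarrow> (nat \<Rightarrow> nat) \<Rightarrow> bool" where
  "reachable n x y \<longleftrightarrow>
     (\<exists>a b. interval_parking_function n a b \<and>
        outcome n a = Some x \<and>
        map_option (conjugate n) (outcome n (conjugate n b)) = Some y)"

definition perm_length :: "nat \<Rightarrow> (nat \<Rightarrow> nat) \<Rightarrow> nat" where
  "perm_length n x = card {(i, j). i \<in> {1..n} \<and> j \<in> {1..n} \<and> i < j \<and> x i > x j}"

definition bruhat_step :: "nat \<Rightarrow> (nat \<Rightarrow> nat) \<Rightarrow> (nat \<Rightarrow> nat) \<Rightarrow> bool" where
  "bruhat_step n x y \<longleftrightarrow> x permutes {1..n} \<and>
     (\<exists>i\<in>{1..n}. \<exists>j\<in>{1..n}. i \<noteq> j \<and>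
        y = transpose i j \<circ> x \<and> perm_length n x > perm_length n y)"

definition bruhat_ge :: "nat \<Rightarrow> (nat \<Rightarrow> nat) \<Rightarrow> (nat \<Rightarrow> nat) \<Rightarrow> bool" where
  "bruhat_ge n = (bruhat_step n)\<^sup>*\<^sup>*"

definition avoids_213 :: "nat \<Rightarrow> (nat \<Rightarrow> nat) \<Rightarrow> bool" where
  "avoids_213 n y \<longleftrightarrow>
     \<not> (\<exists>i1\<in>{1..n}. \<exists>i2\<in>{1..n}. \<exists>i3\<in>{1..n}.
          i1 < i2 \<and> i2 < i3 \<and> y i2 < y i1 \<and> y i1 < y i3)"

end

theory Submission
  imports Defs
begin

text \<open>
  A permutation \<open>w\<close> is the outcome of \<open>a\<close> exactly when, for every car \<open>i\<close>, \<open>a i \<le> w i\<close> and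
  every spot in $[a(i),w(i))$ is taken by some car before \<open>i\<close>; an upper bound \<open>b\<close> changes nothing
  as long as \<open>w i \<le> b i\<close>. With \<open>a = x\<close>, what remains is to find some \<open>b\<close> that dominates \<open>x\<close>
  and satisfies $\mathcal{O}(b^*)^* = y$. Conjugation reverses the street and the queue, so the latter means
  that $y(i)\le b(i)$ and that every spot in $(y(i),b(i)]$ has the form $y(j)$ with $j>i$. Taking \<open>b\<close> as small as
  possible, that is, the pointwise maximum of \<open>x\<close> and \<open>y\<close>, reduces reachability to the condition
  that no $j<i$ satisfies $y(i)<y(j)\le x(i)$ (lemma \<open>reachableI\<close>).

  Of the Bruhat order only a weak consequence is needed: every entry $x(k)$ is dominated by
  some entry $y(m)$ with $m\ge k$ (lemma \<open>bruhat_ge_imp_dominated_to_the_right\<close>). A single step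
  down exchanges the two entries of an inversion, which moves the larger one to the right, and the
  property is transitive. Now if $j<i$ and $y(i)<y(j)\le x(i)$, then some $m\ge i$ has
  $y(m)\ge x(i)\ge y(j)$; this forces $m>i$ and $y(m)>y(j)$, so that $j<i<m$ is an occurrence of
  $213$ in \<open>y\<close>.
\<close>

text \<open>
  The number of inversions is compared by an injection: an inversion is carried along
  with the exchange of positions \<open>p\<close> and \<open>q\<close> whenever the images are still in increasing order. The
  exceptions are inversions between \<open>p\<close> or \<open>q\<close> and a position strictly between them; those survive
  in place, since the entry at \<open>p\<close> does not decrease and the one at \<open>q\<close> does not increase.
\<close>

lemma perm_length_le_swap_ascent:
  assumes pq: "p \<in> {1..n}" "q \<in> {1..n}" "p < q" and asc: "x p \<le> x q"
  shows "perm_length n x \<le> perm_length n (x \<circ> transpose p q)"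
proof -
  let ?t = "transpose p q"
  define inv where
    "inv = (\<lambda>x :: nat \<Rightarrow> nat. {(i, j). i \<in> {1..n} \<and> j \<in> {1..n} \<and> i < j \<and> x i > x j})"
  define f where "f = (\<lambda>(i, j). if ?t i < ?t j then (?t i, ?t j) else (i, j))"
  have t_in: "?t i \<in> {1..n}" if "i \<in> {1..n}" for i
    using that pq by (auto simp: transpose_def)
  have fin: "finite (inv z)" for z
    by (rule finite_subset[of _ "{1..n} \<times> {1..n}"]) (auto simp: inv_def)
  have "inj_on f (inv x)"
  proof (rule inj_onI)
    fix c d assume cd: "c \<in> inv x" "d \<in> inv x" "f c = f d"
    obtain i j where c: "c = (i, j)" by (cases c)
    obtain i' j' where d: "d = (i', j')" by (cases d)
    have "i < j" "i' < j'" using cd c d by (auto simp: inv_def)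
    moreover have "(if ?t i < ?t j then (?t i, ?t j) else (i, j)) =
        (if ?t i' < ?t j' then (?t i', ?t j') else (i', j'))"
      using cd(3) by (simp add: f_def c d)
    ultimately show "c = d"
      unfolding c d by (metis prod.inject transpose_involutory)
  qed
  moreover have "f ` inv x \<subseteq> inv (x \<circ> ?t)"
  proof (clarsimp simp: f_def)
    fix i j assume ij: "(i, j) \<in> inv x"
    show "(?t i < ?t j \<longrightarrow> (?t i, ?t j) \<in> inv (x \<circ> ?t)) \<and>
          (\<not> ?t i < ?t j \<longrightarrow> (i, j) \<in> inv (x \<circ> ?t))"
    proof (intro conjI impI)
      assume "?t i < ?t j"
      then show "(?t i, ?t j) \<in> inv (x \<circ> ?t)"
        using ij t_in by (auto simp: inv_def)
    next
      assume "\<not> ?t i < ?t j"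
      then show "(i, j) \<in> inv (x \<circ> ?t)"
        using ij pq asc by (auto simp: inv_def transpose_def split: if_splits)
    qed
  qed
  ultimately have "card (inv x) \<le> card (inv (x \<circ> ?t))"
    using fin by (intro card_inj_on_le)
  then show ?thesis by (simp add: perm_length_def inv_def)
qed

lemma bruhat_step_swaps_inversion:
  assumes "bruhat_step n x y"
  obtains u v where "u \<in> {1..n}" "v \<in> {1..n}" "u < v" "x u > x v" "y = x \<circ> transpose u v"
proof -
  obtain i j where x: "x permutes {1..n}" and ij: "i \<in> {1..n}" "j \<in> {1..n}" "i \<noteq> j"
    and y: "y = transpose i j \<circ> x" and less: "perm_length n y < perm_length n x"
    using assms by (auto simp: bruhat_step_def)
  have "i \<in> x ` {1..n}" "j \<in> x ` {1..n}"
    using ij by (simp_all only: permutes_image[OF x])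
  then obtain p q where p: "p \<in> {1..n}" "x p = i" and q: "q \<in> {1..n}" "x q = j" by blast
  have inj: "inj x" using x by (rule permutes_inj)
  have y': "y = x \<circ> transpose p q"
    unfolding y using p q inj by (auto simp: fun_eq_iff transpose_def inj_eq)
  have descent: "x u > x v"
    if "u \<in> {1..n}" "v \<in> {1..n}" "u < v" "y = x \<circ> transpose u v" for u v
    using perm_length_le_swap_ascent[OF that(1-3), of x] less that(4) by force
  show thesis
  proof (cases "p < q")
    case True
    show thesis
      by (rule that[OF p(1) q(1) True descent[OF p(1) q(1) True y'] y'])
  next
    case False
    then have "q < p" using p q ij(3) by (metis linorder_neqE_nat)
    have y'': "y = x \<circ> transpose q p" using y' by (simp add: transpose_commute)
    show thesis
      by (rule that[OF q(1) p(1) \<open>q < p\<close> descent[OF q(1) p(1) \<open>q < p\<close> y''] y''])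
  qed
qed

text \<open>
  This is a weakening of the rank-matrix criterion for the Bruhat order, namely its case in which
  all entries of \<open>y\<close> reaching a given threshold lie left of a given position.
\<close>

lemma bruhat_ge_imp_dominated_to_the_right:
  assumes "bruhat_ge n x y" and "k \<in> {1..n}"
  shows "\<exists>m\<in>{k..n}. x k \<le> y m"
  using assms unfolding bruhat_ge_def
proof (induction arbitrary: k rule: converse_rtranclp_induct)
  case base
  then show ?case by auto
next
  case (step x z)
  obtain u v where uv: "u \<in> {1..n}" "v \<in> {1..n}" "u < v" "x u > x v"
    and z: "z = x \<circ> transpose u v"
    using step.hyps(1) by (rule bruhat_step_swaps_inversion)
  \<comment> \<open>The entry of \<open>z\<close> at the right end of the exchange dominates both exchanged entries of \<open>x\<close>.\<close>
  have "x k \<le> z (if k = u then v else k)"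
    using uv by (auto simp: z transpose_def)
  moreover have "(if k = u then v else k) \<in> {k..n}"
    using uv step.prems by auto
  ultimately obtain l where l: "l \<in> {k..n}" "x k \<le> z l" by blast
  then obtain m where "m \<in> {l..n}" "z l \<le> y m"
    using step.IH[of l] step.prems by auto
  with l show ?case by (intro bexI[of _ m]) auto
qed

text \<open>
  Parking is deterministic, so a permutation is recognised as the outcome by a condition
  on each car alone: the spots that it prefers to its own are those of earlier cars.
\<close>

lemma park_eq_permutation:
  assumes inj: "inj_on w {1..n}"
    and between: "\<And>i. i \<in> {1..n} \<Longrightarrow> a i \<le> w i \<and> w i \<le> b i"
    and taken: "\<And>i s. i \<in> {1..n} \<Longrightarrow> a i \<le> s \<Longrightarrow> s < w i \<Longrightarrow> \<exists>j\<in>{1..<i}. w j = s"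
    and "k \<le> n"
  shows "park a b k = Some (\<lambda>i. if i \<in> {1..k} then Some (w i) else None)"
  using \<open>k \<le> n\<close>
proof (induction k)
  case 0
  then show ?case by auto
next
  case (Suc k)
  let ?m = "\<lambda>i. if i \<in> {1..k} then Some (w i) else None"
  have K: "Suc k \<in> {1..n}" using Suc.prems by auto
  have ran: "ran ?m = w ` {1..k}" by (auto simp: ran_def)
  let ?F = "{a (Suc k)..b (Suc k)} - w ` {1..k}"
  have "w (Suc k) \<notin> w ` {1..k}"
  proof
    assume "w (Suc k) \<in> w ` {1..k}"
    then obtain j where "j \<in> {1..k}" "w (Suc k) = w j" by auto
    then show False using inj_onD[OF inj, of "Suc k" j] K by auto
  qed
  then have mem: "w (Suc k) \<in> ?F" using between[OF K] by auto
  have "w (Suc k) \<le> s" if "s \<in> ?F" for s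
  proof (rule ccontr)
    assume "\<not> w (Suc k) \<le> s"
    then have "s < w (Suc k)" by simp
    moreover have "a (Suc k) \<le> s" using that by auto
    ultimately obtain j where "j \<in> {1..<Suc k}" "w j = s"
      using taken[OF K] by blast
    then show False using that by auto
  qed
  then have "Min ?F = w (Suc k)" using mem by (intro Min_eqI) auto
  then have "first_available (ran ?m) (a (Suc k)) (b (Suc k)) = Some (w (Suc k))"
    using mem unfolding first_available_def ran by auto
  moreover have "?m(Suc k \<mapsto> w (Suc k)) = (\<lambda>i. if i \<in> {1..Suc k} then Some (w i) else None)"
    by (auto simp: fun_eq_iff)
  ultimately show ?case using Suc by (simp del: fun_upd_apply)
qed

lemma outcome_eq_permutation:
  assumes w: "w permutes {1..n}"
    and le: "\<And>i. i \<in> {1..n} \<Longrightarrow> a i \<le> w i"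
    and taken: "\<And>i s. i \<in> {1..n} \<Longrightarrow> a i \<le> s \<Longrightarrow> s < w i \<Longrightarrow> \<exists>j\<in>{1..<i}. w j = s"
  shows "outcome n a = Some w"
proof -
  have "park a (\<lambda>_. n) n = Some (\<lambda>i. if i \<in> {1..n} then Some (w i) else None)"
  proof (rule park_eq_permutation[OF permutes_inj_on[OF w] _ taken order_refl])
    show "a i \<le> w i \<and> w i \<le> n" if "i \<in> {1..n}" for i
      using le[OF that] permutes_in_image[OF w, of i] that by auto
  qed
  moreover have "w i = i" if "i \<notin> {1..n}" for i
    using w that by (rule permutes_not_in)
  ultimately show ?thesis by (auto simp: outcome_def fun_eq_iff)
qed

lemma conjugate_conjugate:
  assumes "w permutes {1..n}"
  shows "conjugate n (conjugate n w) = w"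
proof
  fix i
  show "conjugate n (conjugate n w) i = w i"
  proof (cases "i \<in> {1..n}")
    case True
    then have "w i \<in> {1..n}" using permutes_in_image[OF assms] by blast
    with True show ?thesis by (auto simp: conjugate_def)
  next
    case False
    then have "w i = i" by (rule permutes_not_in[OF assms])
    with False show ?thesis by (auto simp: conjugate_def)
  qed
qed

lemma conjugate_permutes:
  assumes w: "w permutes {1..n}"
  shows "conjugate n w permutes {1..n}"
proof (rule bij_imp_permutes)
  have in_range: "w i \<in> {1..n}" if "i \<in> {1..n}" for i
    using permutes_in_image[OF w] that by blast
  have maps: "conjugate n w i \<in> {1..n}" if "i \<in> {1..n}" for i
  proof -
    have "n + 1 - i \<in> {1..n}" using that by auto
    then have "w (n + 1 - i) \<in> {1..n}" by (rule in_range)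
    with that show ?thesis by (auto simp: conjugate_def)
  qed
  show "bij_betw (conjugate n w) {1..n} {1..n}"
  proof (rule bij_betw_imageI)
    show inj: "inj_on (conjugate n w) {1..n}"
    proof (rule inj_onI)
      fix i j assume ij: "i \<in> {1..n}" "j \<in> {1..n}" "conjugate n w i = conjugate n w j"
      then have "n + 1 - i \<in> {1..n}" "n + 1 - j \<in> {1..n}" by auto
      then have "w (n + 1 - i) \<in> {1..n}" "w (n + 1 - j) \<in> {1..n}"
        by (blast intro: in_range)+
      moreover have "n + 1 - w (n + 1 - i) = n + 1 - w (n + 1 - j)"
        using ij by (simp add: conjugate_def)
      ultimately have "w (n + 1 - i) = w (n + 1 - j)"
        unfolding atLeastAtMost_iff by linarith
      then have "n + 1 - i = n + 1 - j" using permutes_inj[OF w] by (simp add: inj_eq)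
      then show "i = j" using ij by auto
    qed
    show "conjugate n w ` {1..n} = {1..n}"
      using maps inj by (intro endo_inj_surj) auto
  qed
  show "conjugate n w i = i" if "i \<notin> {1..n}" for i
    using that by (auto simp: conjugate_def)
qed

text \<open>
  The witnesses are \<open>a = x\<close> and the smallest conceivable \<open>b\<close>: the interval of car \<open>i\<close> must contain
  \<open>x i\<close>, and in the reversed process the car may only move down from \<open>b i\<close> to \<open>y i\<close>.
\<close>

lemma reachableI:
  assumes x: "x permutes {1..n}" and y: "y permutes {1..n}"
    and no_jump: "\<And>i j. i \<in> {1..n} \<Longrightarrow> j \<in> {1..n} \<Longrightarrow> j < i \<Longrightarrow> y i < y j \<Longrightarrow> x i < y j"
  shows "reachable n x y"
proof -
  define b where "b = (\<lambda>i. max (x i) (y i))"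
  have x_in: "x i \<in> {1..n}" if "i \<in> {1..n}" for i
    using permutes_in_image[OF x] that by blast
  have y_in: "y i \<in> {1..n}" if "i \<in> {1..n}" for i
    using permutes_in_image[OF y] that by blast
  have b_in: "b i \<in> {1..n}" if "i \<in> {1..n}" for i
    using x_in[OF that] y_in[OF that] by (auto simp: b_def max_def)
  have "park x b n = Some (\<lambda>i. if i \<in> {1..n} then Some (x i) else None)"
    by (rule park_eq_permutation[OF permutes_inj_on[OF x]]) (auto simp: b_def)
  then have ipf: "interval_parking_function n x b"
    unfolding interval_parking_function_def using x_in b_in by (auto simp: b_def)
  have outcome_x: "outcome n x = Some x"
    by (rule outcome_eq_permutation[OF x]) auto
  have outcome_b: "outcome n (conjugate n b) = Some (conjugate n y)"
  proof (rule outcome_eq_permutation[OF conjugate_permutes[OF y]])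
    fix i assume i: "i \<in> {1..n}"
    define i' where "i' = n + 1 - i"
    have i': "i' \<in> {1..n}" and conj_i: "conjugate n z i = n + 1 - z i'" for z
      using i by (auto simp: i'_def conjugate_def)
    show "conjugate n b i \<le> conjugate n y i"
      by (auto simp: conj_i b_def)
    fix s assume s: "conjugate n b i \<le> s" "s < conjugate n y i"
    define s' where "s' = n + 1 - s"
    have s': "y i' < s'" "s' \<le> b i'" "s' \<in> {1..n}" "s = n + 1 - s'"
      using s y_in[OF i'] b_in[OF i'] by (auto simp: conj_i s'_def)
    have "s' \<in> y ` {1..n}" using s'(3) by (simp only: permutes_image[OF y])
    then obtain j' where j': "j' \<in> {1..n}" "y j' = s'" by blast
    have "\<not> j' < i'"
      using no_jump[OF i' j'(1)] s' j'(2) by (auto simp: b_def)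
    moreover have "j' \<noteq> i'" using s'(1) j'(2) by auto
    ultimately have "n + 1 - j' \<in> {1..<i}" using j'(1) i by (auto simp: i'_def)
    moreover have "conjugate n y (n + 1 - j') = s"
      using j' s'(4) by (auto simp: conjugate_def)
    ultimately show "\<exists>j\<in>{1..<i}. conjugate n y j = s" by blast
  qed
  show ?thesis
    unfolding reachable_def
    using ipf outcome_x outcome_b conjugate_conjugate[OF y] by auto
qed

theorem theorem8p1:
  fixes n :: nat and x y :: "nat \<Rightarrow> nat"
  assumes "n \<ge> 1"
    and "x permutes {1..n}"
    and "y permutes {1..n}"
    and "bruhat_ge n x y"
    and "avoids_213 n y"
  shows "reachable n x y"
proof (rule reachableI[OF assms(2,3)])
  fix i j assume ij: "i \<in> {1..n}" "j \<in> {1..n}" "j < i" "y i < y j"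
  show "x i < y j"
  proof (rule ccontr)
    assume "\<not> x i < y j"
    moreover obtain m where m: "m \<in> {i..n}" "x i \<le> y m"
      using bruhat_ge_imp_dominated_to_the_right[OF assms(4) ij(1)] by blast
    ultimately have ge: "y j \<le> y m" by simp
    then have "m \<noteq> i" using ij(4) by auto
    then have "i < m" using m(1) by simp
    moreover have "y m \<noteq> y j"
      using permutes_inj[OF assms(3)] \<open>i < m\<close> ij(3) by (auto simp: inj_eq)
    ultimately have "i < m \<and> y j < y m" using ge by simp
    moreover have "m \<in> {1..n}" using m(1) ij(1) by auto
    ultimately show False using assms(5) ij unfolding avoids_213_def by blast
  qed
qed

end
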